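(* Let $S$ be a semigroup and let $\sigma:S\to S$ be an involutive morphism. Let $\mu$ be a complex measure that is a linear combination of Dirac measures $(\delta_{z_i})_{i\in I}$ such that $z_i$ is contained in the center of $S$ for all $i\in I$. Let $\mathcal{B}$ be the set of functions $g:S\to\mathbb{C}$ such that $$g(xy)+g(x\sigma(y))=2g(x)g(y)\quad\text{for all }x,y\in S,$$ $$\int_S g(t)\,d\mu(t)=0\quad\text{and}\quad\int_S\int_S g(st)\,d\mu(s)\,d\mu(t)\neq 0.$$ Let $\mathcal{V}$ be the set of non-zero functions $f:S\to\mathbb{C}$ such that $$\int_S f(x\sigma(y)t)\,d\mu(t)-\int_S f(xyt)\,d\mu(t)=2f(x)f(y)\quad\text{for all }x,y\in S.$$ Then the function $J:\mathcal{V}\to\mathcal{B}$ defined by $$Jf(x)=\frac{\int_S f(xt)\,d\mu(t)}{\int_S f(t)\,d\mu(t)},\quad x\in S,$$ is a bijection of $\mathcal{V}$ onto $\mathcal{B}$. In particular $J(\mathcal{V})=\mathcal{B}$.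
   Context: A semigroup is a set with an associative operation, written multiplicatively. An involutive morphism of $S$ is a map $\sigma:S\to S$ with $\sigma(\sigma(x))=x$ for all $x\in S$ that is either an automorphism ($\sigma(xy)=\sigma(x)\sigma(y)$ for all $x,y\in S$) or an anti-automorphism ($\sigma(xy)=\sigma(y)\sigma(x)$ for all $x,y\in S$). The measure is $\mu=\sum_{i\in I}\alpha_i\delta_{z_i}$ (finite linear combination, $\alpha_i\in\mathbb{C}$), so $\int_S h(t)\,d\mu(t)=\sum_i\alpha_i h(z_i)$. That $J$ is well defined (in particular that $\int_S f\,d\mu\neq0$ for $f\in\mathcal{V}$ and that $Jf\in\mathcal{B}$) is part of the assertion. *)

theory Defs
  imports Complex_Main
begin

definition semigroup_center :: "'a::semigroup_mult set" where
  "semigroup_center = {z. \<forall>x. z * x = x * z}"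

definition involutive_morphism :: "('a::semigroup_mult \<Rightarrow> 'a) \<Rightarrow> bool" where
  "involutive_morphism \<sigma> \<longleftrightarrow>
     (\<forall>x. \<sigma> (\<sigma> x) = x) \<and>
     ((\<forall>x y. \<sigma> (x * y) = \<sigma> x * \<sigma> y) \<or> (\<forall>x y. \<sigma> (x * y) = \<sigma> y * \<sigma> x))"

text \<open>
  A complex measure \<open>\<mu> = (\<Sum>i\<in>I. \<alpha> i \<delta>\<^bsub>z i\<^esub>)\<close>, with \<open>I\<close> finite, is represented by the
  triple \<open>I\<close>, \<open>\<alpha>\<close>, \<open>z\<close>; the points \<open>z i\<close> need not be distinct. The following is
  the integral of \<open>h\<close> with respect to \<open>\<mu>\<close>.
\<close>

definition dirac_integral ::
    "'i set \<Rightarrow> ('i \<Rightarrow> complex) \<Rightarrow> ('i \<Rightarrow> 'a) \<Rightarrow> ('a \<Rightarrow> complex) \<Rightarrow> complex" where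
  "dirac_integral I \<alpha> z h = (\<Sum>i\<in>I. \<alpha> i * h (z i))"

definition dAlembert_set ::
    "('a::semigroup_mult \<Rightarrow> 'a) \<Rightarrow> 'i set \<Rightarrow> ('i \<Rightarrow> complex) \<Rightarrow> ('i \<Rightarrow> 'a) \<Rightarrow> ('a \<Rightarrow> complex) set" where
  "dAlembert_set \<sigma> I \<alpha> z = {g.
     (\<forall>x y. g (x * y) + g (x * \<sigma> y) = 2 * g x * g y) \<and>
     dirac_integral I \<alpha> z (\<lambda>t. g t) = 0 \<and>
     dirac_integral I \<alpha> z (\<lambda>t. dirac_integral I \<alpha> z (\<lambda>s. g (s * t))) \<noteq> 0}"

definition van_Vleck_set ::
    "('a::semigroup_mult \<Rightarrow> 'a) \<Rightarrow> 'i set \<Rightarrow> ('i \<Rightarrow> complex) \<Rightarrow> ('i \<Rightarrow> 'a) \<Rightarrow> ('a \<Rightarrow> complex) set" where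
  "van_Vleck_set \<sigma> I \<alpha> z = {f.
     f \<noteq> (\<lambda>x. 0) \<and>
     (\<forall>x y. dirac_integral I \<alpha> z (\<lambda>t. f (x * \<sigma> y * t))
             - dirac_integral I \<alpha> z (\<lambda>t. f (x * y * t)) = 2 * f x * f y)}"

text \<open>
  Division by zero yields \<open>0\<close> in HOL, so \<open>J_map\<close> is the intended quotient only where
  the integral of \<open>f\<close> does not vanish; this has to be asserted separately.
\<close>

definition J_map ::
    "'i set \<Rightarrow> ('i \<Rightarrow> complex) \<Rightarrow> ('i \<Rightarrow> 'a::semigroup_mult) \<Rightarrow> ('a \<Rightarrow> complex) \<Rightarrow> 'a \<Rightarrow> complex" where
  "J_map I \<alpha> z f = (\<lambda>x. dirac_integral I \<alpha> z (\<lambda>t. f (x * t)) / dirac_integral I \<alpha> z (\<lambda>t. f t))"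

end

theory Submission
  imports Defs
begin

text \<open>
  Write \<open>M\<close> for the integral, \<open>T h x = \<integral> h (x t) d\<mu>(t)\<close> and \<open>c = \<integral> f d\<mu>\<close>. A solution \<open>f\<close> of the
  van Vleck equation is odd under \<open>\<sigma>\<close>. Integrating the equation against the central points gives
  \<open>c f (x \<sigma>(y)) = f x \<cdot> T f y - T f x \<cdot> f y\<close>. If \<open>c = 0\<close>, then \<open>T f\<close> is a multiple of \<open>f\<close>, which
  forces \<open>f = 0\<close>. So \<open>c \<noteq> 0\<close>, and \<open>g = T f / c\<close> satisfies a sine subtraction formula
  \<open>f (x \<sigma>(y)) = f x \<cdot> g y - g x \<cdot> f y\<close>. It makes \<open>f\<close> symmetric, from which \<open>\<integral> g d\<mu> = 0\<close> and the
  evenness of \<open>g\<close> follow; then \<open>g\<close> satisfies the d'Alembert equation and \<open>T g = - f\<close>. Hence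
  \<open>g \<mapsto> - T g\<close> is a left inverse of \<open>J\<close>. It is also a right inverse, because
  \<open>T (T g) = (\<integral>\<integral> g(st)) g\<close> for \<open>g\<close> in the d'Alembert set.
\<close>

section \<open>Integration against a combination of central Dirac measures\<close>

locale central_dirac_measure =
  fixes \<sigma> :: "'a::semigroup_mult \<Rightarrow> 'a"
    and I :: "'i set" and \<alpha> :: "'i \<Rightarrow> complex" and z :: "'i \<Rightarrow> 'a"
  assumes involutive: "involutive_morphism \<sigma>"
    and central: "\<And>i. i \<in> I \<Longrightarrow> z i \<in> semigroup_center"
begin

abbreviation M :: "('a \<Rightarrow> complex) \<Rightarrow> complex" where
  "M \<equiv> dirac_integral I \<alpha> z"

definition T :: "('a \<Rightarrow> complex) \<Rightarrow> 'a \<Rightarrow> complex" where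
  "T h x = M (\<lambda>t. h (x * t))"

text \<open>The integral sees only the central points \<open>z i\<close>, so an integrand may be
  rewritten as if its variable commuted with everything.\<close>

lemma M_cong:
  "(\<And>t. t \<in> semigroup_center \<Longrightarrow> h t = k t) \<Longrightarrow> M h = M k"
  unfolding dirac_integral_def by (intro sum.cong) (auto simp: central)

lemma M_add: "M (\<lambda>t. h t + k t) = M h + M k"
  by (simp add: dirac_integral_def algebra_simps sum.distrib)

lemma M_diff: "M (\<lambda>t. h t - k t) = M h - M k"
  by (simp add: dirac_integral_def algebra_simps sum_subtractf)

lemma M_minus: "M (\<lambda>t. - h t) = - M h"
  by (simp add: dirac_integral_def sum_negf)

lemma M_mult_left: "M (\<lambda>t. c * h t) = c * M h"
  by (simp add: dirac_integral_def sum_distrib_left mult.left_commute)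

lemma M_mult_right: "M (\<lambda>t. h t * c) = M h * c"
  by (simp add: dirac_integral_def sum_distrib_right mult.assoc)

lemma M_divide: "M (\<lambda>t. h t / c) = M h / c"
  by (simp add: dirac_integral_def sum_divide_distrib)

lemmas M_linear = M_add M_diff M_minus M_mult_left M_mult_right M_divide

lemma M_swap: "M (\<lambda>s. M (\<lambda>t. h s t)) = M (\<lambda>t. M (\<lambda>s. h s t))"
  unfolding dirac_integral_def sum_distrib_left
  by (subst sum.swap) (simp add: mult_ac)

lemma commute_central: "t \<in> semigroup_center \<Longrightarrow> t * x = x * t"
  by (simp add: semigroup_center_def)

lemma move_central: "t \<in> semigroup_center \<Longrightarrow> x * t * y = x * y * t"
  by (metis mult.assoc commute_central)

lemma \<sigma>_\<sigma> [simp]: "\<sigma> (\<sigma> x) = x"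
  using involutive by (simp add: involutive_morphism_def)

lemma \<sigma>_central:
  assumes t: "t \<in> semigroup_center"
  shows "\<sigma> t \<in> semigroup_center"
proof -
  have "\<sigma> t * \<sigma> (\<sigma> x) = \<sigma> (\<sigma> x) * \<sigma> t" for x
    using involutive commute_central[OF t] unfolding involutive_morphism_def by metis
  then show ?thesis
    by (simp add: semigroup_center_def)
qed

text \<open>In the anti-automorphism case, apply \<sigma> to \<open>t * x\<close> instead. Here the
  two kinds of morphism merge, and later arguments need no case split.\<close>

lemma \<sigma>_mult_central:
  assumes t: "t \<in> semigroup_center"
  shows "\<sigma> (x * t) = \<sigma> x * \<sigma> t"
  using involutive commute_central[OF t] unfolding involutive_morphism_def by metis

text \<open>Since \<open>\<sigma> (\<sigma> x * t) = x * \<sigma> t\<close> for central \<open>t\<close>.\<close>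

lemma integral_\<sigma>_odd:
  assumes "\<And>x. h (\<sigma> x) = - h x"
  shows "M (\<lambda>t. h (x * \<sigma> t)) = - T h (\<sigma> x)"
  unfolding T_def M_minus[symmetric]
  by (rule M_cong) (metis \<sigma>_\<sigma> \<sigma>_mult_central assms)

lemma T_mult_central: "t \<in> semigroup_center \<Longrightarrow> T h (x * t * y) = T h (x * y * t)"
  by (metis move_central)

lemma double_integral:
  "M (\<lambda>t. M (\<lambda>s. h (s * t))) = M (T h)"
  unfolding T_def by (intro M_cong) (simp add: commute_central)

end

section \<open>From van Vleck solutions to d'Alembert solutions\<close>

locale van_Vleck_solution = central_dirac_measure +
  fixes f :: "'a \<Rightarrow> complex"
  assumes f: "f \<in> van_Vleck_set \<sigma> I \<alpha> z"
begin

lemma nonzero: "\<exists>x. f x \<noteq> 0"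
  using f by (auto simp: van_Vleck_set_def)

lemma equation: "T f (x * \<sigma> y) - T f (x * y) = 2 * f x * f y"
  using f by (simp add: van_Vleck_set_def T_def)

text \<open>Replacing \<open>y\<close> by \<open>\<sigma> y\<close> swaps the two terms on the left
  of \<open>equation\<close>.\<close>

lemma odd: "f (\<sigma> y) = - f y"
proof -
  obtain x where x: "f x \<noteq> 0" using nonzero by blast
  have "2 * f x * f (\<sigma> y) = - (2 * f x * f y)"
    by (simp only: equation[symmetric] \<sigma>_\<sigma> minus_diff_eq)
  then have "2 * f x * (f (\<sigma> y) + f y) = 0" by (simp only: distrib_left) simp
  then show ?thesis using x by (simp add: eq_neg_iff_add_eq_0)
qed

abbreviation c :: complex where "c \<equiv> M f"

text \<open>
  Both \<open>2 * f x * T f y\<close> and \<open>2 * T f x * f y\<close> are integrals of the equation; they differ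
  in the \<open>\<sigma>\<close> on the inner integration variable, which costs a term with \<open>c\<close>.
\<close>

lemma subtraction: "f x * T f y - T f x * f y = c * f (x * \<sigma> y)"
proof -
  define H where "H x = M (\<lambda>t. T f (x * \<sigma> t))" for x
  have H: "H x - T (T f) x = 2 * c * f x" for x
  proof -
    have "H x - T (T f) x = M (\<lambda>t. T f (x * \<sigma> t) - T f (x * t))"
      by (simp add: H_def T_def[of "T f"] M_diff)
    also have "\<dots> = M (\<lambda>t. 2 * f x * f t)"
      by (simp add: equation)
    finally show ?thesis by (simp add: M_linear)
  qed
  have "2 * f x * T f y = M (\<lambda>t. 2 * f x * f (y * t))"
    by (simp add: M_linear T_def)
  also have "\<dots> = M (\<lambda>t. T f (x * \<sigma> y * \<sigma> t) - T f (x * y * t))"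
    by (rule M_cong) (metis equation \<sigma>_mult_central mult.assoc)
  also have "\<dots> = H (x * \<sigma> y) - T (T f) (x * y)"
    by (simp add: H_def T_def[of "T f"] M_diff)
  finally have 1: "2 * f x * T f y = H (x * \<sigma> y) - T (T f) (x * y)" .
  have "2 * T f x * f y = M (\<lambda>t. 2 * f (x * t) * f y)"
    by (simp add: M_linear T_def)
  also have "\<dots> = M (\<lambda>t. T f (x * \<sigma> y * t) - T f (x * y * t))"
    by (rule M_cong) (metis equation T_mult_central)
  also have "\<dots> = T (T f) (x * \<sigma> y) - T (T f) (x * y)"
    by (simp add: T_def[of "T f"] M_diff)
  finally have 2: "2 * T f x * f y = T (T f) (x * \<sigma> y) - T (T f) (x * y)" .
  have "2 * (f x * T f y - T f x * f y) = 2 * (c * f (x * \<sigma> y))"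
    using 1 2 H[of "x * \<sigma> y"] by algebra
  then show ?thesis unfolding mult_cancel_left by simp
qed

lemma integral_nonzero: "c \<noteq> 0"
proof
  assume c0: "c = 0"
  obtain a where a: "f a \<noteq> 0" using nonzero by blast
  define l where "l = T f a / f a"
  have F: "T f x = l * f x" for x
    using subtraction[of x a] a c0 by (simp add: l_def field_simps)
  have l: "l \<noteq> 0"
    using equation[of a a] a by (auto simp: F)
  \<comment> \<open>Adding the equation at \<open>(s, x)\<close> and at \<open>(x, s)\<close>
    cancels the two terms with \<sigma>, because \<open>f\<close> is odd.\<close>
  have "l * f (x * s) = - 2 * f s * f x" if s: "s \<in> semigroup_center" for x s
  proof -
    have "f (s * \<sigma> x) = - f (x * \<sigma> s)"
      by (metis odd \<sigma>_mult_central \<sigma>_central s commute_central \<sigma>_\<sigma>)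
    then show ?thesis
      using equation[of s x] equation[of x s] unfolding F commute_central[OF s, of x] by algebra
  qed
  \<comment> \<open>Integration over \<open>s\<close> gives \<open>l * T f a\<close>, that is
    \<open>l^2 * f a\<close>, on the left and a multiple of \<open>c = 0\<close> on the
    right.\<close>
  then have "M (\<lambda>s. l * f (a * s)) = M (\<lambda>s. - 2 * f s * f a)"
    by (rule M_cong)
  also have "\<dots> = 0"
    using M_mult_right[of "\<lambda>s. -2 * f s" "f a"] M_mult_left[of "-2" f] c0 by simp
  finally have "l * T f a = 0" by (simp add: M_linear T_def)
  then show False using l a by (simp add: F)
qed

abbreviation g :: "'a \<Rightarrow> complex" where "g \<equiv> J_map I \<alpha> z f"

lemma T_f: "T f x = c * g x"
  using integral_nonzero by (simp add: J_map_def T_def)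

lemma f_mult_\<sigma>: "f (x * \<sigma> y) = f x * g y - g x * f y"
proof -
  have "c * (f x * g y - g x * f y) = c * f (x * \<sigma> y)"
    using subtraction[of x y] by (simp add: T_f algebra_simps)
  then show ?thesis using integral_nonzero by simp
qed

lemma f_mult: "f (x * y) = f x * g (\<sigma> y) + g x * f y"
  using f_mult_\<sigma>[of x "\<sigma> y"] by (simp add: odd)

text \<open>Oddness of \<open>f\<close> rewrites \<open>T f (\<sigma> y)\<close> as an integral to
  which \<open>f_mult_\<sigma>\<close> applies. The term with \<open>M g\<close> is the obstruction
  to evenness of \<open>g\<close>.\<close>

lemma g_\<sigma>: "c * g (\<sigma> y) = c * g y - M g * f y"
proof -
  have "c * g (\<sigma> y) = - M (\<lambda>t. f (y * \<sigma> t))"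
    using integral_\<sigma>_odd[of f, OF odd, of y] by (simp add: T_f)
  also have "\<dots> = - M (\<lambda>t. f y * g t - g y * f t)"
    by (simp add: f_mult_\<sigma>)
  finally show ?thesis by (simp add: M_linear algebra_simps)
qed

lemma f_commute: "f (x * y) = f (y * x)"
proof -
  have E: "c * f (x * y) = f x * (c * g y - M g * f y) + c * g x * f y" for x y
    unfolding f_mult g_\<sigma>[symmetric] by (simp add: algebra_simps)
  have "c * f (x * y) = c * f (y * x)"
    unfolding E by (simp add: algebra_simps)
  then show ?thesis using integral_nonzero by simp
qed

lemma c_g_mult_\<sigma>: "c * g (x * \<sigma> y) = c * g x * g y - T g x * f y"
proof -
  have "T f (x * \<sigma> y) = M (\<lambda>t. f (x * t) * g y - g (x * t) * f y)"
    unfolding T_def by (rule M_cong) (simp add: move_central[symmetric] f_mult_\<sigma>)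
  also have "\<dots> = T f x * g y - T g x * f y"
    by (simp add: M_linear T_def)
  finally show ?thesis by (simp add: T_f)
qed

text \<open>Expand both terms of \<open>equation\<close> by \<open>c_g_mult_\<sigma>\<close> and
  \<open>g_\<sigma>\<close>, then cancel a nonzero value \<open>f y\<close>.\<close>

lemma T_g: "2 * T g x = M g * g x - 2 * f x"
proof -
  obtain y where y: "f y \<noteq> 0" using nonzero by blast
  have "c * g (x * y) = g x * (c * g (\<sigma> y)) + T g x * f y"
    using c_g_mult_\<sigma>[of x "\<sigma> y"] by (simp add: odd)
  then have "f y * (M g * g x - 2 * T g x) = f y * (2 * f x)"
    using equation[of x y] by (simp add: T_f c_g_mult_\<sigma> g_\<sigma> algebra_simps)
  then show ?thesis unfolding mult_cancel_left using y by (simp add: algebra_simps)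
qed

text \<open>Symmetry of \<open>f\<close> passes to \<open>T f\<close>, hence to \<open>g\<close>,
  while the antisymmetric part of the formula for \<open>2 * c * g (x * y)\<close> is
  \<open>M g * f (x * \<sigma> y)\<close>. If \<open>M g\<close> were nonzero, \<open>f\<close>
  would vanish on all products.\<close>

lemma integral_g: "M g = 0"
proof (rule ccontr)
  assume a: "M g \<noteq> 0"
  have comm: "T f (x * y) = T f (y * x)" for x y
    unfolding T_def
  proof (rule M_cong)
    fix t :: 'a
    assume "t \<in> semigroup_center"
    then show "f (x * y * t) = f (y * x * t)"
      by (metis f_commute mult.assoc commute_central)
  qed
  have E: "2 * c * g (x * y) = 2 * c * g x * g y - M g * g x * f y - 2 * f x * f y" for x y
  proof -
    have "c * g (x * y) = g x * (c * g (\<sigma> y)) + T g x * f y"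
      using c_g_mult_\<sigma>[of x "\<sigma> y"] by (simp add: odd)
    then have "2 * c * g (x * y) = 2 * g x * (c * g y - M g * f y) + (2 * T g x) * f y"
      unfolding g_\<sigma> by algebra
    then show ?thesis unfolding T_g by (simp add: algebra_simps)
  qed
  have "f (x * \<sigma> y) = 0" for x y
  proof -
    have "2 * c * g (x * y) = 2 * c * g (y * x)"
      using comm[of x y] by (simp add: T_f)
    then have "M g * (f x * g y - g x * f y) = 0"
      unfolding E by (simp add: algebra_simps)
    then show ?thesis using a by (simp add: f_mult_\<sigma>)
  qed
  then have "f (x * y) = 0" for x y
    by (metis \<sigma>_\<sigma>)
  then have "T f x = 0" for x
    by (simp add: T_def dirac_integral_def)
  then show False
    using equation nonzero by fastforce
qed

lemma T_J: "T g x = - f x"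
  using T_g[of x] by (simp add: integral_g)

lemma J_in_dAlembert_set: "g \<in> dAlembert_set \<sigma> I \<alpha> z"
proof -
  have even: "g (\<sigma> y) = g y" for y
    using g_\<sigma>[of y] integral_nonzero by (simp add: integral_g)
  \<comment> \<open>The terms with \<open>T g x\<close> cancel in the sum, since \<open>f\<close> is
    odd.\<close>
  have "c * (g (x * y) + g (x * \<sigma> y)) = c * (2 * g x * g y)" for x y
    using c_g_mult_\<sigma>[of x y] c_g_mult_\<sigma>[of x "\<sigma> y"]
    by (simp add: odd even algebra_simps)
  then have "g (x * y) + g (x * \<sigma> y) = 2 * g x * g y" for x y
    using integral_nonzero by simp
  moreover have "M (T g) \<noteq> 0"
    unfolding T_J[abs_def] M_minus using integral_nonzero by simp
  ultimately show ?thesis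
    by (simp add: dAlembert_set_def integral_g double_integral)
qed

end

section \<open>From d'Alembert solutions back to van Vleck solutions\<close>

locale dAlembert_solution = central_dirac_measure +
  fixes g :: "'a \<Rightarrow> complex"
  assumes g: "g \<in> dAlembert_set \<sigma> I \<alpha> z"
begin

lemma equation: "g (x * y) + g (x * \<sigma> y) = 2 * g x * g y"
  using g by (simp add: dAlembert_set_def)

lemma integral: "M g = 0"
  using g by (simp add: dAlembert_set_def)

abbreviation d :: complex where "d \<equiv> M (T g)"

lemma d_nonzero: "d \<noteq> 0"
  using g by (simp add: dAlembert_set_def double_integral)

text \<open>Integrating the equation over \<open>y\<close> kills its right-hand side, as
  \<open>M g = 0\<close>.\<close>

lemma integral_\<sigma>: "M (\<lambda>s. g (x * \<sigma> s)) = - T g x"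
proof -
  have "T g x + M (\<lambda>s. g (x * \<sigma> s)) = M (\<lambda>s. 2 * g x * g s)"
    unfolding T_def M_add[symmetric] equation ..
  then show ?thesis
    by (simp add: M_linear integral eq_neg_iff_add_eq_0 add.commute)
qed

lemma integral_T_\<sigma>: "M (\<lambda>s. T g (x * \<sigma> s)) = - T (T g) x"
proof -
  have "M (\<lambda>s. T g (x * \<sigma> s)) = M (\<lambda>t. M (\<lambda>s. g (x * \<sigma> s * t)))"
    unfolding T_def by (rule M_swap)
  also have "\<dots> = M (\<lambda>t. M (\<lambda>s. g (x * t * \<sigma> s)))"
    by (intro M_cong) (metis move_central)
  also have "\<dots> = M (\<lambda>t. - T g (x * t))"
    by (simp only: integral_\<sigma>)
  finally show ?thesis by (simp only: M_minus T_def[of "T g"])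
qed

lemma integral_mult_\<sigma>:
  "M (\<lambda>t. M (\<lambda>s. g (x * s * \<sigma> (y * t)))) = - T (T g) (x * \<sigma> y)"
proof -
  have "M (\<lambda>t. M (\<lambda>s. g (x * s * \<sigma> (y * t)))) = M (\<lambda>t. T g (x * \<sigma> y * \<sigma> t))"
    unfolding T_def
  proof (intro M_cong)
    fix t s :: 'a
    assume "t \<in> semigroup_center" "s \<in> semigroup_center"
    then show "g (x * s * \<sigma> (y * t)) = g (x * \<sigma> y * \<sigma> t * s)"
      by (metis move_central \<sigma>_mult_central mult.assoc)
  qed
  then show ?thesis by (simp only: integral_T_\<sigma>)
qed

lemma T_T: "T (T g) x = d * g x"
proof -
  have "2 * g x * d = M (\<lambda>t. M (\<lambda>s. 2 * g x * g (t * s)))"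
    by (simp only: M_mult_left T_def[abs_def])
  also have "\<dots> = M (\<lambda>t. M (\<lambda>s. g (x * (t * s)))) + M (\<lambda>t. M (\<lambda>s. g (x * \<sigma> (t * s))))"
    by (simp only: equation[symmetric] M_add)
  also have "M (\<lambda>t. M (\<lambda>s. g (x * (t * s)))) = T (T g) x"
    by (simp add: T_def mult.assoc)
  also have "M (\<lambda>t. M (\<lambda>s. g (x * \<sigma> (t * s)))) = M (\<lambda>t. M (\<lambda>s. g (x * \<sigma> t * \<sigma> s)))"
    by (intro M_cong) (simp add: \<sigma>_mult_central mult.assoc)
  \<comment> \<open>Both variables carry \<sigma>, each contributes a sign, and the signs
    cancel.\<close>
  also have "\<dots> = T (T g) x"
    by (simp only: integral_\<sigma> M_minus integral_T_\<sigma> minus_minus)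
  finally show ?thesis by (simp add: mult.commute)
qed

text \<open>Integrate the equation at \<open>x * s\<close> and \<open>y * t\<close> over both
  variables. In the second term only \<open>t\<close> carries \<sigma>, which leaves a single minus
  sign; the result is the van Vleck equation for \<open>- T g\<close>.\<close>

lemma T_mult_T: "2 * T g x * T g y = d * (g (x * y) - g (x * \<sigma> y))"
proof -
  have "2 * T g x * T g y = M (\<lambda>t. M (\<lambda>s. 2 * g (x * s) * g (y * t)))"
    by (simp add: M_linear T_def)
  also have "\<dots> = M (\<lambda>t. M (\<lambda>s. g (x * s * (y * t)))) + M (\<lambda>t. M (\<lambda>s. g (x * s * \<sigma> (y * t))))"
    by (simp only: equation[symmetric] M_add)
  also have "M (\<lambda>t. M (\<lambda>s. g (x * s * (y * t)))) = T (T g) (x * y)"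
    unfolding T_def by (intro M_cong) (metis move_central mult.assoc)
  finally show ?thesis
    unfolding integral_mult_\<sigma> T_T by (simp add: algebra_simps)
qed

abbreviation f :: "'a \<Rightarrow> complex" where "f \<equiv> \<lambda>x. - T g x"

lemma integral_f: "M f = - d"
  by (rule M_minus)

lemma T_f: "T f x = - d * g x"
  unfolding T_T[symmetric] minus_mult_left[symmetric]
  by (simp add: T_def[of f] T_def[of "T g"] M_minus)

lemma f_in_van_Vleck_set: "f \<in> van_Vleck_set \<sigma> I \<alpha> z"
proof -
  have "f \<noteq> (\<lambda>x. 0)"
  proof
    assume "f = (\<lambda>x. 0)"
    then have "M f = 0" by (simp only:) (simp add: dirac_integral_def)
    then show False using d_nonzero unfolding integral_f by simp
  qed
  moreover have "T f (x * \<sigma> y) - T f (x * y) = 2 * f x * f y" for x y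
    using T_mult_T[of x y] by (simp add: T_f algebra_simps)
  ultimately show ?thesis
    by (simp add: van_Vleck_set_def T_def)
qed

lemma J_f: "J_map I \<alpha> z f = g"
proof
  fix x
  have "J_map I \<alpha> z f x = T f x / M f"
    by (simp only: J_map_def T_def)
  also have "\<dots> = g x"
    unfolding T_f integral_f using d_nonzero by simp
  finally show "J_map I \<alpha> z f x = g x" .
qed

end

theorem theorem4p2:
  fixes \<sigma> :: "'a::semigroup_mult \<Rightarrow> 'a"
    and I :: "'i set"
    and \<alpha> :: "'i \<Rightarrow> complex"
    and z :: "'i \<Rightarrow> 'a"
  assumes "involutive_morphism \<sigma>"
    and "finite I"
    and "\<And>i. i \<in> I \<Longrightarrow> z i \<in> semigroup_center"
  shows "(\<forall>f \<in> van_Vleck_set \<sigma> I \<alpha> z. dirac_integral I \<alpha> z (\<lambda>t. f t) \<noteq> 0) \<and>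
         bij_betw (J_map I \<alpha> z) (van_Vleck_set \<sigma> I \<alpha> z) (dAlembert_set \<sigma> I \<alpha> z) \<and>
         J_map I \<alpha> z ` van_Vleck_set \<sigma> I \<alpha> z = dAlembert_set \<sigma> I \<alpha> z"
proof -
  interpret central_dirac_measure \<sigma> I \<alpha> z
    using assms by unfold_locales
  have V: "van_Vleck_solution \<sigma> I \<alpha> z f" if "f \<in> van_Vleck_set \<sigma> I \<alpha> z" for f
    using that by unfold_locales
  have B: "dAlembert_solution \<sigma> I \<alpha> z g" if "g \<in> dAlembert_set \<sigma> I \<alpha> z" for g
    using that by unfold_locales
  have "bij_betw (J_map I \<alpha> z) (van_Vleck_set \<sigma> I \<alpha> z) (dAlembert_set \<sigma> I \<alpha> z)"
  proof (rule bij_betw_byWitness[where f' = "\<lambda>g x. - T g x"])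
    show "\<forall>f \<in> van_Vleck_set \<sigma> I \<alpha> z. (\<lambda>x. - T (J_map I \<alpha> z f) x) = f"
      using van_Vleck_solution.T_J[OF V] by simp
    show "\<forall>g \<in> dAlembert_set \<sigma> I \<alpha> z. J_map I \<alpha> z (\<lambda>x. - T g x) = g"
      using dAlembert_solution.J_f[OF B] by blast
    show "J_map I \<alpha> z ` van_Vleck_set \<sigma> I \<alpha> z \<subseteq> dAlembert_set \<sigma> I \<alpha> z"
      using van_Vleck_solution.J_in_dAlembert_set[OF V] by blast
    show "(\<lambda>g x. - T g x) ` dAlembert_set \<sigma> I \<alpha> z \<subseteq> van_Vleck_set \<sigma> I \<alpha> z"
      using dAlembert_solution.f_in_van_Vleck_set[OF B] by blast
  qed
  then show ?thesis
    using van_Vleck_solution.integral_nonzero[OF V] by (simp add: bij_betw_imp_surj_on)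
qed

end
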